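(* Let $\tilde W_S>0$, $\tilde E_B\ge0$, $L/\xi\ge1$, $\kappa\in(0,1)$, let $\theta$ be a nonconstant solution of the boundary value problem (BVP) given in the context, and set $p_x(x)=\cos\theta(x)$. 1. Let $\tilde E_B<1$. Then: (a) If $p_x(0)>\tilde E_B$ and $p_x(1)<0$, then $\tilde W_S>\max\left\{\tilde E_B\frac{\xi}{L},\sqrt{2\tilde E_B-1}\right\}$ if $\tilde E_B\ge\frac12$, and $\tilde W_S>\tilde E_B\frac{\xi}{L}$ if $\tilde E_B\in[0,\frac12)$. (b) If $p_x(0)>\tilde E_B$ and $p_x(1)>0$, then $\tilde W_S<\min\left\{\sqrt{\frac{1-(1-\kappa)\tilde E_B^2}{\kappa}},\ \sqrt{\tilde E_B^2+\frac{1+\kappa}{8}\left(\frac{\pi\xi}{L}\right)^2}\right\}$. (c) If $p_x(0)<\tilde E_B$ and $p_x(1)<0$, then $\sqrt{\frac{1-(1-\kappa)\tilde E_B^2}{\kappa}}<\tilde W_S<\frac{\pi\xi}{L}\sqrt{\frac{(1+\kappa)-(1-\kappa^2)\tilde E_B^2}{2(1-\tilde E_B^2)}}$. (d) If $p_x(0)<\tilde E_B$ and $p_x(1)>0$, then $\tilde W_S<\min\left\{\sqrt{\tilde E_B^2+\frac{1+\kappa}{8}\left(\frac{\pi\xi}{L}\right)^2},\ \frac{\pi\xi}{L}\sqrt{\frac{1+\kappa}{8}\left(\frac{1-(1-\kappa)\tilde E_B^2}{1-\tilde E_B^2}\right)}\right\}$. 2. Let $\tilde E_B<1$. If $$\tilde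 W_S>\max\left\{\sqrt{\tilde E_B^2+\frac{1+\kappa}{2}\left(\frac{\pi\xi}{L}\right)^2},\ \frac{\pi\xi}{L}\sqrt{\frac{1+\kappa}{2}\left(1+\frac{\kappa\tilde E_B^2}{1-\tilde E_B^2}\right)}\right\},$$ then $p_x(0)>\tilde E_B$ and $p_x(1)<0$. 3. If $\tilde E_B>\frac{1+\tilde W_S^2}{2}$, then $p_x(1)>0$. Moreover, if $\tilde E_B>1+\frac{\tilde W_S^2}{\kappa}$, then $p_x(x)=1$ for all $x\in[0,1]$.
   Context: Parameters: $\tilde W_S$ (surface anchoring strength), $\tilde E_B$ (bias field), $L/\xi$ (ratio of cell thickness to correlation length, $L,\xi>0$), $\kappa$ (bend-to-splay ratio) are real numbers with $\tilde W_S>0$, $\tilde E_B\ge0$, $L/\xi\ge1$, $\kappa\in(0,1)$. (BVP): the Euler-Lagrange equation $$(\sin^2\theta+\kappa\cos^2\theta)\theta''+\tfrac12(1-\kappa)\sin 2\theta\,(\theta')^2+\tfrac12\left(\tfrac{L}{\xi}\right)^2\sin2\theta-\tilde E_B\left(\tfrac L\xi\right)^2\sin\theta=0\quad\text{on }(0,1)$$ with the nonlinear boundary conditions $$-\tilde W_S\left(\tfrac L\xi\right)\sin\theta+(\sin^2\theta+\kappa\cos^2\theta)\theta'=0\quad\text{at }x=0\text{ and }x=1.$$ A solution is a (smooth) function $\theta:[0,1]\to[0,\pi]$ satisfying the equation and both boundary conditions. Under the stated convention that $\theta$ is nonconstant, the last assertion of part 3 amounts to saying that no nonconstant solution exists when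 $\tilde E_B>1+\tilde W_S^2/\kappa$. *)

theory Defs
  imports "HOL-Analysis.Analysis"
begin

text \<open>Functions on \<open>[0,1]\<close> are represented by total functions \<open>real \<Rightarrow> real\<close> whose values outside
  \<open>[0,1]\<close> are irrelevant. Derivatives are therefore taken within \<open>[0,1]\<close>: they are one-sided at
  the end points and agree with the ordinary derivative in the interior.\<close>

definition dI :: "(real \<Rightarrow> real) \<Rightarrow> real \<Rightarrow> real" where
  "dI f x = vector_derivative f (at x within {0..1})"

definition smoothI :: "(real \<Rightarrow> real) \<Rightarrow> bool" where
  "smoothI f \<longleftrightarrow> (\<forall>n. (dI ^^ n) f differentiable_on {0..1})"

definition euler_lagrange :: "real \<Rightarrow> real \<Rightarrow> real \<Rightarrow> real \<Rightarrow> (real \<Rightarrow> real) \<Rightarrow> real \<Rightarrow> bool" where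
  "euler_lagrange E_B L \<xi> \<kappa> \<theta> x \<longleftrightarrow>
     ((sin (\<theta> x))\<^sup>2 + \<kappa> * (cos (\<theta> x))\<^sup>2) * dI (dI \<theta>) x
     + 1 / 2 * (1 - \<kappa>) * sin (2 * \<theta> x) * (dI \<theta> x)\<^sup>2
     + 1 / 2 * (L / \<xi>)\<^sup>2 * sin (2 * \<theta> x)
     - E_B * (L / \<xi>)\<^sup>2 * sin (\<theta> x) = 0"

definition boundary_cond :: "real \<Rightarrow> real \<Rightarrow> real \<Rightarrow> real \<Rightarrow> (real \<Rightarrow> real) \<Rightarrow> real \<Rightarrow> bool" where
  "boundary_cond W_S L \<xi> \<kappa> \<theta> x \<longleftrightarrow>
     - W_S * (L / \<xi>) * sin (\<theta> x)
     + ((sin (\<theta> x))\<^sup>2 + \<kappa> * (cos (\<theta> x))\<^sup>2) * dI \<theta> x = 0"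

definition bvp_solution ::
    "real \<Rightarrow> real \<Rightarrow> real \<Rightarrow> real \<Rightarrow> real \<Rightarrow> (real \<Rightarrow> real) \<Rightarrow> bool" where
  "bvp_solution W_S E_B L \<xi> \<kappa> \<theta> \<longleftrightarrow>
     smoothI \<theta> \<and> \<theta> \<in> {0..1} \<rightarrow> {0..pi} \<and>
     (\<forall>x\<in>{0<..<1}. euler_lagrange E_B L \<xi> \<kappa> \<theta> x) \<and>
     boundary_cond W_S L \<xi> \<kappa> \<theta> 0 \<and> boundary_cond W_S L \<xi> \<kappa> \<theta> 1"

definition p_x :: "(real \<Rightarrow> real) \<Rightarrow> real \<Rightarrow> real" where
  "p_x \<theta> x = cos (\<theta> x)"

end

theory Submission
  imports Defs
begin

text \<open>Write \<open>p = cos \<theta>\<close> and \<open>g = 1 - (1 - \<kappa>) p\<^sup>2\<close>. The equation has the first integral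
  \<open>g \<theta>'\<^sup>2 = l\<^sup>2 Q(p)\<close> with \<open>Q(p) = p\<^sup>2 - 2 E p + D\<close>, and the equilibrium \<open>p = E\<close> is a saddle.
  Hence a nonconstant solution stays strictly between \<open>0\<close> and \<open>\<pi>\<close> and is strictly increasing:
  either \<open>p\<close> attains \<open>E\<close>, and then \<open>D > E\<^sup>2\<close> and \<open>Q\<close> has no zero, or \<open>p - E\<close> has a fixed sign, and
  then \<open>\<surd>g \<theta>'\<close> is monotone with positive values at both ends.

  Inserting the boundary conditions into the first integral gives
  \<open>W\<^sup>2 (1 - p\<^sup>2) / g = Q(p)\<close> at both ends. Subtracting the two identities yields
  \<open>(p(0) + p(1)) (1 + \<kappa> W\<^sup>2 / (g(p(0)) g(p(1)))) = 2 E\<close>, from which the algebraic bounds follow.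
  The bounds involving \<open>\<pi>\<close> come from the transit time: if \<open>Q \<ge> q\<close> along the solution then
  \<open>l \<surd>q \<le> \<integral> \<surd>g d\<theta>\<close>, and \<open>g\<close> has mean \<open>(1 + \<kappa>) / 2\<close> over \<open>[0, \<pi>/2]\<close> and \<open>[0, \<pi>]\<close>.\<close>

section \<open>Uniqueness by a Gronwall estimate\<close>

text \<open>The squared deviation u satisfies |u'| \<le> 2 K u. Hence
  \<open>u x * exp (2 * K * x)\<close> is nondecreasing up to z and
  \<open>u x * exp (- 2 * K * x)\<close> is nonincreasing after z. Both vanish at z, so u vanishes
  on each side.\<close>

lemma constant_if_derivative_bounded_by_deviation:
  fixes f f' :: "real \<Rightarrow> real"
  assumes der: "\<And>x. x \<in> {a..b} \<Longrightarrow> (f has_real_derivative f' x) (at x within {a..b})"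
    and bound: "\<And>x. x \<in> {a..b} \<Longrightarrow> (f' x)\<^sup>2 \<le> K\<^sup>2 * (f x - f z)\<^sup>2"
    and z: "z \<in> {a..b}" and K: "K \<ge> 0"
  shows "f constant_on {a..b}"
proof -
  define u where "u = (\<lambda>x. (f x - f z)\<^sup>2)"
  have abs_bound: "\<bar>2 * (f x - f z) * f' x\<bar> \<le> 2 * K * u x" if "x \<in> {a..b}" for x
  proof -
    have "\<bar>f' x\<bar> \<le> K * \<bar>f x - f z\<bar>"
      using bound[OF that] K power2_le_iff_abs_le[of "K * \<bar>f x - f z\<bar>" "f' x"]
      by (simp add: power_mult_distrib)
    then have "\<bar>f x - f z\<bar> * \<bar>f' x\<bar> \<le> \<bar>f x - f z\<bar> * (K * \<bar>f x - f z\<bar>)"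
      by (intro mult_left_mono) auto
    also have "\<dots> = K * u x"
      by (simp add: u_def power2_eq_square abs_mult_self_eq)
    finally show ?thesis
      unfolding abs_mult by simp
  qed
  have weighted: "((\<lambda>x. u x * exp (s * x)) has_real_derivative
      (2 * (f x - f z) * f' x + s * u x) * exp (s * x)) (at x within S)"
    if "x \<in> {a..b}" "S \<subseteq> {a..b}" for x s S
    unfolding u_def using DERIV_subset[OF der[OF that(1)] that(2)]
    by (auto intro!: derivative_eq_intros simp: algebra_simps)
  have cont: "continuous_on S (\<lambda>x. u x * exp (s * x))" if "S \<subseteq> {a..b}" for S s
    unfolding u_def
    by (intro continuous_intros continuous_on_subset[OF DERIV_continuous_on[OF der] that])
  have "f x = f z" if x: "x \<in> {a..b}" for x
  proof (cases "x \<le> z")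
    case True
    have "u x * exp (2 * K * x) \<le> u z * exp (2 * K * z)"
    proof (rule DERIV_nonneg_imp_increasing_open[of x z "\<lambda>x. u x * exp (2 * K * x)"])
      fix t assume t: "x < t" "t < z"
      show "\<exists>y. ((\<lambda>x. u x * exp (2 * K * x)) has_real_derivative y) (at t) \<and> 0 \<le> y"
        using weighted[of t "{a<..<b}" "2 * K"] abs_bound[of t] t x z
        by (force simp: at_within_open[of t "{a<..<b}"] intro!: exI[of _ "(2 * (f t - f z) * f' t + 2 * K * u t) * exp (2 * K * t)"] )
    next
      show "continuous_on {x..z} (\<lambda>x. u x * exp (2 * K * x))"
        using cont x z by simp
    qed (use True in auto)
    then show ?thesis by (simp add: u_def mult_le_0_iff)
  next
    case False
    have "u x * exp (- 2 * K * x) \<le> u z * exp (- 2 * K * z)"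
    proof (rule DERIV_nonpos_imp_decreasing_open[of z x "\<lambda>x. u x * exp (- 2 * K * x)"])
      fix t assume t: "z < t" "t < x"
      show "\<exists>y. ((\<lambda>x. u x * exp (- 2 * K * x)) has_real_derivative y) (at t) \<and> y \<le> 0"
        using weighted[of t "{a<..<b}" "- 2 * K"] abs_bound[of t] t x z
        by (force simp: at_within_open[of t "{a<..<b}"] mult_le_0_iff intro!: exI[of _ "(2 * (f t - f z) * f' t + - 2 * K * u t) * exp (- 2 * K * t)"] )
    next
      show "continuous_on {z..x} (\<lambda>x. u x * exp (- 2 * K * x))"
        using cont[of _ "- 2 * K"] x z by simp
    qed (use False in auto)
    then show ?thesis by (simp add: u_def mult_le_0_iff)
  qed
  then show ?thesis unfolding constant_on_def by blast
qed

section \<open>The problem in abstract form and its first integral\<close>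

text \<open>The derivatives are parameters, so that \<open>dI\<close> enters only when the theorem
  interprets the locale. Here \<open>l\<close> stands for L / \<xi>.\<close>

locale nematic_bvp =
  fixes W E l \<kappa> :: real and \<theta> \<theta>' \<theta>'' :: "real \<Rightarrow> real"
  assumes W: "W > 0" and E: "E \<ge> 0" and l: "l \<ge> 1" and \<kappa>: "0 < \<kappa>" "\<kappa> < 1"
    and \<theta>': "\<And>x. x \<in> {0..1} \<Longrightarrow> (\<theta> has_real_derivative \<theta>' x) (at x within {0..1})"
    and \<theta>'': "\<And>x. x \<in> {0..1} \<Longrightarrow> (\<theta>' has_real_derivative \<theta>'' x) (at x within {0..1})"
    and range: "\<And>x. x \<in> {0..1} \<Longrightarrow> \<theta> x \<in> {0..pi}"
    and EL: "\<And>x. x \<in> {0<..<1} \<Longrightarrow>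
      ((sin (\<theta> x))\<^sup>2 + \<kappa> * (cos (\<theta> x))\<^sup>2) * \<theta>'' x
      + 1 / 2 * (1 - \<kappa>) * sin (2 * \<theta> x) * (\<theta>' x)\<^sup>2
      + 1 / 2 * l\<^sup>2 * sin (2 * \<theta> x) - E * l\<^sup>2 * sin (\<theta> x) = 0"
    and BC: "\<And>x. x \<in> {0, 1} \<Longrightarrow>
      ((sin (\<theta> x))\<^sup>2 + \<kappa> * (cos (\<theta> x))\<^sup>2) * \<theta>' x = W * l * sin (\<theta> x)"
    and nonconstant: "\<not> \<theta> constant_on {0..1}"
begin

definition p :: "real \<Rightarrow> real" where "p x = cos (\<theta> x)"

definition g :: "real \<Rightarrow> real" where "g t = 1 - (1 - \<kappa>) * t\<^sup>2"

text \<open>The integration constant of the first integral, taken at x = 0 and scaled by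
  l^2.\<close>

definition D :: real where "D = g (p 0) * (\<theta>' 0)\<^sup>2 / l\<^sup>2 - (p 0)\<^sup>2 + 2 * E * p 0"

definition Q :: "real \<Rightarrow> real" where "Q t = t\<^sup>2 - 2 * E * t + D"

lemma g_p: "g (p x) = (sin (\<theta> x))\<^sup>2 + \<kappa> * (cos (\<theta> x))\<^sup>2"
  unfolding g_def p_def sin_squared_eq by (simp add: algebra_simps)

lemma Q_eq: "Q t = (t - E)\<^sup>2 + (D - E\<^sup>2)"
  by (simp add: Q_def power2_eq_square algebra_simps)

lemma p_square_le_1: "(p x)\<^sup>2 \<le> 1"
  by (simp add: p_def abs_square_le_1)

lemma g_ge:
  assumes "t\<^sup>2 \<le> 1"
  shows "\<kappa> \<le> g t"
proof -
  have "0 \<le> (1 - \<kappa>) * (1 - t\<^sup>2)"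
    using \<kappa> assms by simp
  then show ?thesis by (simp add: g_def algebra_simps)
qed

lemma g_le_1: "g t \<le> 1"
  using \<kappa> by (simp add: g_def)

lemma g_p_pos: "g (p x) > 0"
  using g_ge[OF p_square_le_1[of x]] \<kappa> by linarith

lemma \<theta>'_interior: "x \<in> {0<..<1} \<Longrightarrow> (\<theta> has_real_derivative \<theta>' x) (at x)"
  using \<theta>'[of x] at_within_Icc_at[of 0 x 1] by auto

lemma \<theta>''_interior: "x \<in> {0<..<1} \<Longrightarrow> (\<theta>' has_real_derivative \<theta>'' x) (at x)"
  using \<theta>''[of x] at_within_Icc_at[of 0 x 1] by auto

lemma continuous_\<theta>: "continuous_on {0..1} \<theta>"
  using \<theta>' by (rule DERIV_continuous_on)

lemma continuous_\<theta>': "continuous_on {0..1} \<theta>'"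
  using \<theta>'' by (rule DERIV_continuous_on)

lemma continuous_p: "continuous_on {0..1} p"
  unfolding p_def by (intro continuous_intros continuous_\<theta>)

lemma p_derivative:
  "x \<in> {0<..<1} \<Longrightarrow> (p has_real_derivative - sin (\<theta> x) * \<theta>' x) (at x)"
  unfolding p_def by (rule derivative_eq_intros \<theta>'_interior refl | simp)+

lemma EL_p: "x \<in> {0<..<1} \<Longrightarrow>
  g (p x) * \<theta>'' x = l\<^sup>2 * sin (\<theta> x) * (E - p x) - (1 - \<kappa>) * sin (\<theta> x) * p x * (\<theta>' x)\<^sup>2"
  using EL[of x] unfolding g_p sin_double by (simp add: p_def field_simps)

text \<open>The derivative of H is 2 \<theta>' times the residual of the Euler-Lagrange equation. So
  H is constant up to the ends, and D absorbs its value at 0.\<close>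

lemma energy:
  assumes "x \<in> {0..1}"
  shows "g (p x) * (\<theta>' x)\<^sup>2 = l\<^sup>2 * Q (p x)"
proof -
  define H where "H = (\<lambda>x. g (p x) * (\<theta>' x)\<^sup>2 - l\<^sup>2 * ((p x)\<^sup>2 - 2 * E * p x))"
  have "H x = H 0"
  proof (rule DERIV_isconst2[of 0 1 H])
    show "continuous_on {0..1} H"
      unfolding H_def g_def by (intro continuous_intros continuous_p continuous_\<theta>')
  next
    fix y :: real assume y: "0 < y" "y < 1"
    then have y': "y \<in> {0<..<1}" by simp
    have "(H has_real_derivative 2 * \<theta>' y * (g (p y) * \<theta>'' y
        - (l\<^sup>2 * sin (\<theta> y) * (E - p y) - (1 - \<kappa>) * sin (\<theta> y) * p y * (\<theta>' y)\<^sup>2))) (at y)"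
      unfolding H_def g_def
      by (rule derivative_eq_intros p_derivative[OF y'] \<theta>''_interior[OF y'] refl)+
        (simp add: power2_eq_square algebra_simps)
    then show "(H has_real_derivative 0) (at y)"
      using EL_p[OF y'] by simp
  qed (use assms in auto)
  moreover have "l\<^sup>2 * D = g (p 0) * (\<theta>' 0)\<^sup>2 - l\<^sup>2 * ((p 0)\<^sup>2 - 2 * E * p 0)"
    using l by (simp add: D_def algebra_simps)
  ultimately show ?thesis
    by (simp add: H_def Q_def algebra_simps)
qed

lemma Q_nonneg:
  assumes "x \<in> {0..1}"
  shows "Q (p x) \<ge> 0"
proof -
  have "0 \<le> l\<^sup>2 * Q (p x)"
    using energy[OF assms] g_p_pos[of x] by (metis less_eq_real_def mult_nonneg_nonneg zero_le_power2)
  then show ?thesis using l by (simp add: zero_le_mult_iff)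
qed

section \<open>Confinement to (0, \<pi>) and strict monotonicity\<close>

text \<open>Since \<kappa> \<le> g, the first integral turns a quadratic bound on Q into a linear
  bound on |\<theta>'|, and the Gronwall lemma makes \<theta> constant. This excludes contact with 0
  or \<pi> and arrival at the saddle p = E with zero slope.\<close>

lemma not_Q_le_deviation:
  assumes z: "z \<in> {0..1}" and M: "M \<ge> 0"
    and le: "\<And>x. x \<in> {0..1} \<Longrightarrow> Q (p x) \<le> M * (\<theta> x - \<theta> z)\<^sup>2"
  shows False
proof -
  have "(\<theta>' x)\<^sup>2 \<le> (l * sqrt (M / \<kappa>))\<^sup>2 * (\<theta> x - \<theta> z)\<^sup>2" if x: "x \<in> {0..1}" for x
  proof -
    have "\<kappa> * (\<theta>' x)\<^sup>2 \<le> g (p x) * (\<theta>' x)\<^sup>2"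
      by (intro mult_right_mono g_ge p_square_le_1) simp
    also have "\<dots> \<le> l\<^sup>2 * (M * (\<theta> x - \<theta> z)\<^sup>2)"
      unfolding energy[OF x] by (intro mult_left_mono le x) simp
    finally show ?thesis
      using \<kappa> M by (simp add: power_mult_distrib field_simps)
  qed
  then have "\<theta> constant_on {0..1}"
    using l M \<kappa>
    by (intro constant_if_derivative_bounded_by_deviation[OF \<theta>' _ z, of "l * sqrt (M / \<kappa>)"]) auto
  then show False using nonconstant by blast
qed

text \<open>At a contact point the slope vanishes: at an end by the boundary condition, in the
  interior because the range makes it an extremum. So Q (p z) = 0, and Q is of second order in
  \<theta> - \<theta> z because cos is stationary at 0 and \<pi>.\<close>

lemma \<theta>_interior:
  assumes z: "z \<in> {0..1}"
  shows "0 < \<theta> z" "\<theta> z < pi"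
proof -
  have "\<theta> z \<noteq> 0 \<and> \<theta> z \<noteq> pi"
  proof (rule ccontr)
    assume "\<not> ?thesis"
    then have ends: "\<theta> z = 0 \<or> \<theta> z = pi" by blast
    have "\<theta>' z = 0"
    proof (cases "z \<in> {0, 1}")
      case True
      then show ?thesis
        using BC[OF True] ends g_p_pos[of z] unfolding g_p by auto
    next
      case False
      then have z': "z \<in> {0<..<1}" using z by auto
      have near: "0 < min z (1 - z)" using z' by auto
      show ?thesis
        using ends
      proof
        assume "\<theta> z = 0"
        show ?thesis
          by (rule DERIV_local_min[OF \<theta>'_interior[OF z'] near])
            (use range \<open>\<theta> z = 0\<close> in \<open>auto simp: abs_less_iff\<close>)
      next
        assume "\<theta> z = pi"
        show ?thesis
          by (rule DERIV_local_max[OF \<theta>'_interior[OF z'] near])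
            (use range \<open>\<theta> z = pi\<close> in \<open>auto simp: abs_less_iff\<close>)
      qed
    qed
    then have Q0: "Q (p z) = 0"
      using energy[OF z] l by simp
    \<comment> \<open>Q (p x) - Q (p z) factors into p x - p z, at most (\<theta> x - \<theta> z)^2
      / 2 in modulus, and p x + p z - 2 E, at most 2 + 2 E. Their product gives the constant 1 +
      E.\<close>
    have "Q (p x) \<le> (1 + E) * (\<theta> x - \<theta> z)\<^sup>2" if "x \<in> {0..1}" for x
    proof -
      have "\<bar>p x - p z\<bar> = 1 - cos (\<theta> x - \<theta> z)"
        using ends
      proof
        have "\<bar>cos (\<theta> x) + 1\<bar> = cos (\<theta> x) + 1"
          using cos_ge_minus_one[of "\<theta> x"] by linarith
        then show ?thesis if "\<theta> z = pi" using that by (simp add: p_def)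
      qed (simp add: p_def)
      also have "\<dots> = 2 * (sin ((\<theta> x - \<theta> z) / 2))\<^sup>2"
        using cos_double_sin[of "(\<theta> x - \<theta> z) / 2"]
        unfolding nonzero_mult_div_cancel_left[OF zero_neq_numeral[symmetric]] times_divide_eq_right by linarith
      also have "\<dots> \<le> 2 * ((\<theta> x - \<theta> z) / 2)\<^sup>2"
        using abs_sin_x_le_abs_x[of "(\<theta> x - \<theta> z) / 2"]
        by (simp add: abs_le_square_iff del: abs_divide)
      finally have 1: "\<bar>p x - p z\<bar> \<le> (\<theta> x - \<theta> z)\<^sup>2 / 2"
        by (simp add: power_divide)
      have 2: "\<bar>p x + p z - 2 * E\<bar> \<le> 2 + 2 * E"
        using abs_cos_le_one[of "\<theta> x"] abs_cos_le_one[of "\<theta> z"] E unfolding p_def by linarith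
      have "Q (p x) = Q (p x) - Q (p z)" using Q0 by simp
      also have "\<dots> = (p x - p z) * (p x + p z - 2 * E)"
        by (simp add: Q_def power2_eq_square algebra_simps)
      also have "\<dots> \<le> \<bar>p x - p z\<bar> * \<bar>p x + p z - 2 * E\<bar>"
        by (metis abs_ge_self abs_mult)
      also have "\<dots> \<le> ((\<theta> x - \<theta> z)\<^sup>2 / 2) * (2 + 2 * E)"
        by (intro mult_mono 1 2) auto
      finally show ?thesis by (simp add: field_simps)
    qed
    then show False
      using not_Q_le_deviation[OF z, of "1 + E"] E by simp
  qed
  then show "0 < \<theta> z" "\<theta> z < pi"
    using range[OF z] by auto
qed

lemma sin_pos: "x \<in> {0..1} \<Longrightarrow> sin (\<theta> x) > 0"
  using \<theta>_interior by (simp add: sin_gt_zero)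

lemma abs_p_less_1: "x \<in> {0..1} \<Longrightarrow> \<bar>p x\<bar> < 1"
  using zero_less_power[OF sin_pos[of x], of 2]
  by (simp add: p_def cos_squared_eq flip: abs_square_less_1)

lemma \<theta>'_boundary:
  assumes "x \<in> {0, 1}"
  shows "\<theta>' x = W * l * sin (\<theta> x) / g (p x)" "\<theta>' x > 0"
proof -
  show eq: "\<theta>' x = W * l * sin (\<theta> x) / g (p x)"
    using BC[OF assms] g_p_pos[of x] unfolding g_p by (simp add: field_simps)
  show "\<theta>' x > 0"
    unfolding eq using W l sin_pos[of x] g_p_pos[of x] assms by auto
qed

lemma p_above_or_below:
  assumes "\<And>x. x \<in> {0..1} \<Longrightarrow> p x \<noteq> E"
  shows "(\<forall>x\<in>{0..1}. p x > E) \<or> (\<forall>x\<in>{0..1}. p x < E)"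
proof (rule ccontr)
  assume "\<not> ?thesis"
  then obtain a b where ab: "a \<in> {0..1}" "b \<in> {0..1}" "p a \<le> E" "p b \<ge> E" by force
  have "connected (p ` {0..1})"
    by (intro connected_continuous_image continuous_p) simp
  then have "E \<in> p ` {0..1}"
    using ab unfolding connected_iff_interval by blast
  then show False using assms by blast
qed

text \<open>The weight \<surd>g absorbs the \<theta>'^2 term of the equation, so the sign of this
  derivative is that of E - p.\<close>

lemma scaled_slope_derivative:
  assumes "x \<in> {0<..<1}"
  shows "((\<lambda>x. sqrt (g (p x)) * \<theta>' x) has_real_derivative
    l\<^sup>2 * sin (\<theta> x) * (E - p x) / sqrt (g (p x))) (at x)"
proof -
  have g': "((\<lambda>x. g (p x)) has_real_derivative 2 * (1 - \<kappa>) * p x * sin (\<theta> x) * \<theta>' x) (at x)"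
    unfolding g_def by (rule derivative_eq_intros p_derivative[OF assms] refl | simp)+
  have "((\<lambda>x. sqrt (g (p x)) * \<theta>' x) has_real_derivative
      (inverse (sqrt (g (p x))) / 2 * (2 * (1 - \<kappa>) * p x * sin (\<theta> x) * \<theta>' x)) * \<theta>' x
      + \<theta>'' x * sqrt (g (p x))) (at x)"
    by (rule DERIV_mult[OF DERIV_chain2[OF DERIV_real_sqrt[OF g_p_pos] g'] \<theta>''_interior[OF assms]])
  moreover have "(inverse (sqrt (g (p x))) / 2 * (2 * (1 - \<kappa>) * p x * sin (\<theta> x) * \<theta>' x)) * \<theta>' x
      + \<theta>'' x * sqrt (g (p x)) = ((1 - \<kappa>) * sin (\<theta> x) * p x * (\<theta>' x)\<^sup>2 + g (p x) * \<theta>'' x) / sqrt (g (p x))"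
  proof -
    define r where "r = sqrt (g (p x))"
    have "r > 0" "g (p x) = r\<^sup>2" using g_p_pos[of x] by (simp_all add: r_def)
    then show ?thesis unfolding r_def[symmetric] by (simp add: field_simps power2_eq_square)
  qed
  ultimately show ?thesis
    unfolding EL_p[OF assms] by simp
qed

lemma \<theta>'_pos:
  assumes x: "x \<in> {0..1}"
  shows "\<theta>' x > 0"
proof (cases "\<exists>z\<in>{0..1}. p z = E")
  case True
  then obtain z where z: "z \<in> {0..1}" "p z = E" by blast
  have "D \<ge> E\<^sup>2" using Q_nonneg[OF z(1)] by (simp add: Q_eq z(2))
  moreover have "D \<noteq> E\<^sup>2"
  proof
    assume "D = E\<^sup>2"
    \<comment> \<open>Now Q is (p - E)^2, and cos is 1-Lipschitz, so M = 1 serves in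
      \<open>not_Q_le_deviation\<close>.\<close>
    have "Q (p x) \<le> 1 * (\<theta> x - \<theta> z)\<^sup>2" for x
    proof -
      have "\<bar>cos (\<theta> x) - cos (\<theta> z)\<bar>
          = 2 * \<bar>sin ((\<theta> x + \<theta> z) / 2)\<bar> * \<bar>sin ((\<theta> z - \<theta> x) / 2)\<bar>"
        by (simp add: cos_diff_cos abs_mult)
      also have "\<dots> \<le> 2 * 1 * \<bar>(\<theta> z - \<theta> x) / 2\<bar>"
        by (intro mult_mono abs_sin_x_le_abs_x) auto
      finally have "\<bar>p x - E\<bar> \<le> \<bar>\<theta> x - \<theta> z\<bar>"
        unfolding z(2)[symmetric] p_def by simp
      then show ?thesis
        unfolding Q_eq \<open>D = E\<^sup>2\<close> by (simp add: abs_le_square_iff)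
    qed
    then show False by (rule not_Q_le_deviation[OF z(1), rotated]) simp
  qed
  \<comment> \<open>With Q free of zeros, \<theta>' has none either and keeps the positive sign it
    has at x = 0.\<close>
  ultimately have Q_pos: "Q t > 0" for t
    by (simp add: Q_eq add_nonneg_pos)
  have nz: "\<theta>' y \<noteq> 0" if "y \<in> {0..1}" for y
    using energy[OF that] Q_pos[of "p y"] l by auto
  show ?thesis
  proof (rule ccontr)
    assume "\<not> ?thesis"
    then have "\<exists>y\<ge>0. y \<le> x \<and> \<theta>' y = 0"
      using x \<theta>'_boundary(2)[of 0] continuous_on_subset[OF continuous_\<theta>']
      by (intro IVT2') auto
    then show False using nz x by auto
  qed
next
  case False
  \<comment> \<open>Here ?v is monotone and is compared with the end where it is smallest: x = 1 if
    p > E, x = 0 if p < E.\<close>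
  let ?v = "\<lambda>x. sqrt (g (p x)) * \<theta>' x"
  have cont: "continuous_on {a..b} ?v" if "a \<ge> 0" "b \<le> 1" for a b
    unfolding g_def using that
    by (intro continuous_intros continuous_on_subset[OF continuous_p] continuous_on_subset[OF continuous_\<theta>']) auto
  have v_pos: "?v 0 > 0" "?v 1 > 0"
    using \<theta>'_boundary(2) g_p_pos by auto
  from False have "(\<forall>x\<in>{0..1}. p x > E) \<or> (\<forall>x\<in>{0..1}. p x < E)"
    using p_above_or_below by blast
  then have "?v x > 0"
  proof
    assume above: "\<forall>x\<in>{0..1}. p x > E"
    have "?v 1 \<le> ?v x"
    proof (rule DERIV_nonpos_imp_decreasing_open[of x 1 ?v])
      fix y assume y: "x < y" "y < 1"
      then have "y \<in> {0<..<1}" "y \<in> {0..1}" using x by auto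
      then show "\<exists>d. (?v has_real_derivative d) (at y) \<and> d \<le> 0"
        using scaled_slope_derivative[of y] bspec[OF above, of y] sin_pos[of y] g_p_pos[of y]
        by (intro exI conjI) (auto simp: divide_le_0_iff mult_le_0_iff)
    qed (use x cont in auto)
    then show ?thesis using v_pos by linarith
  next
    assume below: "\<forall>x\<in>{0..1}. p x < E"
    have "?v 0 \<le> ?v x"
    proof (rule DERIV_nonneg_imp_increasing_open[of 0 x ?v])
      fix y assume y: "0 < y" "y < x"
      then have "y \<in> {0<..<1}" "y \<in> {0..1}" using x by auto
      then show "\<exists>d. (?v has_real_derivative d) (at y) \<and> 0 \<le> d"
        using scaled_slope_derivative[of y] bspec[OF below, of y] sin_pos[of y] g_p_pos[of y]
        by (intro exI conjI) (auto simp: zero_le_divide_iff zero_le_mult_iff)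
    qed (use x cont in auto)
    then show ?thesis using v_pos by linarith
  qed
  then show ?thesis using g_p_pos[of x] by (simp add: zero_less_mult_iff)
qed

lemma \<theta>_less:
  assumes "x \<in> {0..1}" "y \<in> {0..1}" "x < y"
  shows "\<theta> x < \<theta> y"
proof (rule DERIV_pos_imp_increasing_open[OF assms(3)])
  fix z assume "x < z" "z < y"
  then have "z \<in> {0<..<1}" "z \<in> {0..1}" using assms by auto
  then show "\<exists>d. (\<theta> has_real_derivative d) (at z) \<and> d > 0"
    using \<theta>'_interior \<theta>'_pos by blast
qed (use assms in \<open>auto intro: continuous_on_subset[OF continuous_\<theta>]\<close>)

lemma p_less: "x \<in> {0..1} \<Longrightarrow> y \<in> {0..1} \<Longrightarrow> x < y \<Longrightarrow> p y < p x"
  unfolding p_def using \<theta>_less[of x y] range[of x] range[of y] by (intro cos_monotone_0_pi) auto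

section \<open>Identities from the boundary conditions\<close>

lemma boundary_energy:
  assumes "x \<in> {0, 1}"
  shows "W\<^sup>2 * (1 - (p x)\<^sup>2) / g (p x) = Q (p x)"
proof -
  have "1 - (p x)\<^sup>2 = (sin (\<theta> x))\<^sup>2"
    by (simp add: p_def sin_squared_eq)
  then have "g (p x) * (\<theta>' x)\<^sup>2 = l\<^sup>2 * (W\<^sup>2 * (1 - (p x)\<^sup>2) / g (p x))"
    unfolding \<theta>'_boundary(1)[OF assms] using g_p_pos[of x]
    by (simp only:) (simp add: power2_eq_square)
  then have "l\<^sup>2 * (W\<^sup>2 * (1 - (p x)\<^sup>2) / g (p x)) = l\<^sup>2 * Q (p x)"
    using energy[of x] assms by auto
  then show ?thesis
    using l by (subst (asm) mult_left_cancel) auto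
qed

lemma boundary_sum:
  "(p 0 + p 1) * (1 + \<kappa> * W\<^sup>2 / (g (p 0) * g (p 1))) = 2 * E"
proof -
  define a b where "a = p 0" and "b = p 1"
  have ne: "a - b \<noteq> 0" using p_less[of 0 1] by (simp add: a_def b_def)
  have pos: "g a > 0" "g b > 0" by (simp_all add: a_def b_def g_p_pos)
  \<comment> \<open>Over the common denominator the a^2 b^2 terms cancel. What remains contains the
    factor a - b, which Q a - Q b has as well.\<close>
  have diff: "(1 - a\<^sup>2) / g a - (1 - b\<^sup>2) / g b = - \<kappa> * (a\<^sup>2 - b\<^sup>2) / (g a * g b)"
  proof -
    have "(1 - a\<^sup>2) * g b - (1 - b\<^sup>2) * g a = - \<kappa> * (a\<^sup>2 - b\<^sup>2)"
      by (simp add: g_def algebra_simps)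
    then show ?thesis using pos by (simp add: divide_simps)
  qed
  have "Q a - Q b = W\<^sup>2 * ((1 - a\<^sup>2) / g a - (1 - b\<^sup>2) / g b)"
    using boundary_energy[of 0] boundary_energy[of 1] by (simp add: a_def b_def algebra_simps)
  then have "(a - b) * ((a + b) * (1 + \<kappa> * W\<^sup>2 / (g a * g b))) = (a - b) * (2 * E)"
    unfolding diff by (simp add: Q_def power2_eq_square algebra_simps diff_divide_distrib)
  then show ?thesis using ne by (simp add: a_def b_def)
qed

lemma sum_factor_gt_1: "1 + \<kappa> * W\<^sup>2 / (g (p 0) * g (p 1)) > 1"
  using \<kappa> W g_p_pos by simp

lemma boundary_sum_nonneg: "p 0 + p 1 \<ge> 0"
proof -
  have "0 \<le> (p 0 + p 1) * (1 + \<kappa> * W\<^sup>2 / (g (p 0) * g (p 1)))"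
    unfolding boundary_sum using E by simp
  then show ?thesis using sum_factor_gt_1 by (simp add: zero_le_mult_iff)
qed

section \<open>The transit-time estimate\<close>

text \<open>The condition on b covers the two values used, \<pi>/2 and \<pi>, for which g (cos t)
  has mean (1 + \<kappa>) / 2 over [0, b]. Strictness comes from \<theta> 0 > 0.\<close>

lemma transit_bound:
  assumes q: "q \<ge> 0" "\<And>x. x \<in> {0..1} \<Longrightarrow> q \<le> Q (p x)"
    and b: "\<theta> 1 \<le> b" "sin (2 * b) = 0"
  shows "l\<^sup>2 * q < (1 + \<kappa>) / 2 * b\<^sup>2"
proof -
  define c where "c = sqrt ((1 + \<kappa>) / 2)"
  have c: "c > 0" "c\<^sup>2 = (1 + \<kappa>) / 2" using \<kappa> by (auto simp: c_def)
  define m where "m = l * sqrt q"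
  have m: "m \<ge> 0" "m\<^sup>2 = l\<^sup>2 * q" using l q by (auto simp: m_def power_mult_distrib)
  \<comment> \<open>The primitive of (g (cos t) + c^2) / 2 vanishing at 0. Its sine term vanishes at
    b too, so H b = c^2 b.\<close>
  define H where "H = (\<lambda>t. c\<^sup>2 * t - (1 - \<kappa>) / 8 * sin (2 * t))"
  have H': "(H has_real_derivative (g (cos t) + c\<^sup>2) / 2) (at t within S)" for t S
    unfolding H_def g_def c(2)
    by (rule derivative_eq_intros refl)+ (simp only: cos_double_cos, simp add: field_simps)
  have H'_pos: "(g (cos t) + c\<^sup>2) / 2 > 0" for t
    using g_ge[of "cos t"] abs_square_le_1[of "cos t"] abs_cos_le_one[of t] \<kappa> c by (simp add: add_pos_pos)
  have H_mono: "H s < H t" if "s < t" for s t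
    using that H' H'_pos by (intro DERIV_pos_imp_increasing[of s t H]) blast+
  \<comment> \<open>Monotonicity of this difference replaces integration of the slope inequality
    over [0, 1].\<close>
  have "m * c * 0 - H (\<theta> 0) \<ge> m * c * 1 - H (\<theta> 1)"
  proof (rule DERIV_nonpos_imp_decreasing_open[of 0 1 "\<lambda>x. m * c * x - H (\<theta> x)"])
    show "continuous_on {0..1} (\<lambda>x. m * c * x - H (\<theta> x))"
      unfolding H_def by (intro continuous_intros continuous_\<theta>)
  next
    fix x :: real assume "0 < x" "x < 1"
    then have x: "x \<in> {0<..<1}" "x \<in> {0..1}" by auto
    have "m\<^sup>2 \<le> (sqrt (g (p x)) * \<theta>' x)\<^sup>2"
      using energy[OF x(2)] q(2)[OF x(2)] g_p_pos[of x] m(2) l by (simp add: power_mult_distrib)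
    then have "m \<le> sqrt (g (p x)) * \<theta>' x"
      by (rule power2_le_imp_le) (use g_p_pos[of x] \<theta>'_pos[OF x(2)] in auto)
    then have "m * c \<le> (sqrt (g (p x)) * c) * \<theta>' x"
      using mult_right_mono[of m "sqrt (g (p x)) * \<theta>' x" c] c(1) by (simp add: mult_ac)
    also have "\<dots> \<le> (g (p x) + c\<^sup>2) / 2 * \<theta>' x"
    proof (rule mult_right_mono)
      \<comment> \<open>AM-GM linearises \<open>\<surd>g\<close>, so that the majorant has the elementary primitive \<open>H\<close>.\<close>
      show "sqrt (g (p x)) * c \<le> (g (p x) + c\<^sup>2) / 2"
        using arith_geo_mean_sqrt[of "g (p x)" "c\<^sup>2"] g_p_pos[of x] c(1) by (simp add: real_sqrt_mult)
    qed (use \<theta>'_pos[OF x(2)] in simp)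
    finally have le: "m * c - (g (p x) + c\<^sup>2) / 2 * \<theta>' x \<le> 0" by simp
    have "((\<lambda>x. m * c * x - H (\<theta> x)) has_real_derivative m * c - (g (p x) + c\<^sup>2) / 2 * \<theta>' x) (at x)"
      unfolding p_def
      by (rule derivative_eq_intros DERIV_chain2[OF H'] \<theta>'_interior[OF x(1)] refl | simp)+
    with le show "\<exists>y. ((\<lambda>x. m * c * x - H (\<theta> x)) has_real_derivative y) (at x) \<and> y \<le> 0" by blast
  qed auto
  moreover have "H (\<theta> 0) > 0"
    using H_mono[of 0 "\<theta> 0"] \<theta>_interior(1)[of 0] by (simp add: H_def)
  moreover have "H (\<theta> 1) \<le> H b"
    using H_mono[of "\<theta> 1" b] b(1) by (cases "\<theta> 1 = b") auto
  ultimately have "m * c < c\<^sup>2 * b"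
    using b(2) by (simp add: H_def)
  then have "m < c * b"
    using c(1) by (simp add: power2_eq_square)
  then have "m\<^sup>2 < (c * b)\<^sup>2"
    using m(1) by (simp add: power_strict_mono)
  then show ?thesis by (simp add: m(2) c(2) power_mult_distrib)
qed

lemma \<theta>_1_le_half_pi: "p 1 \<ge> 0 \<Longrightarrow> \<theta> 1 \<le> pi / 2"
  using cos_monotone_0_pi[of "pi / 2" "\<theta> 1"] \<theta>_interior[of 1] by (force simp: p_def)

section \<open>Bounds relating W and E\<close>

text \<open>The identity at x = 1 gives D - W^2 = b (2 E - b (1 + \<kappa> W^2 / g b)) with b = p 1.
  The bracket is nonnegative by \<open>boundary_sum\<close>, since p 0 \<ge> 0 and g (p 0) \<le>
  1.\<close>

lemma W_square_le_D:
  assumes "p 1 \<ge> 0"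
  shows "W\<^sup>2 \<le> D"
proof -
  define a b where "a = p 0" and "b = p 1"
  have b: "0 \<le> b" "b < a" using assms p_less[of 0 1] by (auto simp: a_def b_def)
  have pos: "g a > 0" "g b > 0" by (simp_all add: a_def b_def g_p_pos)
  have "b * (1 + \<kappa> * W\<^sup>2 / g b) \<le> (a + b) * (1 + \<kappa> * W\<^sup>2 / (g a * g b))"
  proof (intro mult_mono add_mono order_refl divide_left_mono)
    show "g a * g b \<le> g b" using g_le_1[of a] pos by simp
  qed (use b pos \<kappa> in auto)
  also have "\<dots> = 2 * E" using boundary_sum by (simp add: a_def b_def)
  finally have "0 \<le> b * (2 * E - b * (1 + \<kappa> * W\<^sup>2 / g b))"
    using b by simp
  also have "\<dots> = W\<^sup>2 * (1 - b\<^sup>2) / g b - W\<^sup>2 - b\<^sup>2 + 2 * E * b"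
  proof -
    have "W\<^sup>2 * (1 - b\<^sup>2) / g b - W\<^sup>2 = - b * (b * (\<kappa> * W\<^sup>2 / g b))"
      using pos(2) by (simp add: field_simps) (simp add: g_def power2_eq_square algebra_simps)
    then show ?thesis by (simp add: power2_eq_square algebra_simps)
  qed
  also have "\<dots> = D - W\<^sup>2"
    using boundary_energy[of 1] by (simp add: b_def Q_def)
  finally show ?thesis by simp
qed

text \<open>Q \<ge> D - E^2 \<ge> W^2 - E^2, and p 1 \<ge> 0 allows b = \<pi>/2 in
  \<open>transit_bound\<close>.\<close>

lemma W_bound_p1_nonneg:
  assumes "p 1 \<ge> 0"
  shows "W\<^sup>2 < E\<^sup>2 + (1 + \<kappa>) / 8 * (pi / l)\<^sup>2"
proof (cases "W\<^sup>2 \<le> E\<^sup>2")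
  case True
  moreover have "(1 + \<kappa>) / 8 * (pi / l)\<^sup>2 > 0" using \<kappa> l by simp
  ultimately show ?thesis by linarith
next
  case False
  have "l\<^sup>2 * (W\<^sup>2 - E\<^sup>2) < (1 + \<kappa>) / 2 * (pi / 2)\<^sup>2"
  proof (rule transit_bound)
    show "W\<^sup>2 - E\<^sup>2 \<le> Q (p x)" for x
      unfolding Q_eq using W_square_le_D[OF assms] by (simp add: add_increasing)
  qed (use False \<theta>_1_le_half_pi[OF assms] in auto)
  then show ?thesis using l by (simp add: field_simps)
qed

text \<open>As p decreases from p 0 \<le> E, Q (p x) is smallest at x = 0. There it equals W^2 (1 -
  t^2) / g t at t = p 0, which decreases in t^2 and so is at least its value at t = E.\<close>

lemma W_bound_p0_le:
  assumes "E < 1" "p 0 \<le> E" "\<theta> 1 \<le> b" "sin (2 * b) = 0"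
  shows "W\<^sup>2 < (1 + \<kappa>) / 2 * (b / l)\<^sup>2 * (g E / (1 - E\<^sup>2))"
proof -
  have p0: "p 0 \<ge> 0" using boundary_sum_nonneg p_less[of 0 1] by simp
  have sq: "(p 0)\<^sup>2 \<le> E\<^sup>2" "E\<^sup>2 < 1"
    using p0 assms(1,2) E by (auto simp: power_mono abs_square_less_1)
  have gE: "g E > 0" using g_ge[of E] sq \<kappa> by simp
  have "(1 - E\<^sup>2) / g E \<le> (1 - (p 0)\<^sup>2) / g (p 0)"
  proof -
    have "(1 - (p 0)\<^sup>2) * g E - (1 - E\<^sup>2) * g (p 0) = \<kappa> * (E\<^sup>2 - (p 0)\<^sup>2)"
      by (simp add: g_def algebra_simps)
    also have "\<dots> \<ge> 0" using \<kappa> sq by simp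
    finally show ?thesis using gE g_p_pos[of 0] by (simp add: divide_simps)
  qed
  then have low: "W\<^sup>2 * ((1 - E\<^sup>2) / g E) \<le> Q (p 0)"
    unfolding boundary_energy[of 0, symmetric, simplified] times_divide_eq_right[symmetric]
    by (rule mult_left_mono) simp
  have "l\<^sup>2 * (W\<^sup>2 * ((1 - E\<^sup>2) / g E)) < (1 + \<kappa>) / 2 * b\<^sup>2"
  proof (rule transit_bound)
    fix x :: real assume x: "x \<in> {0..1}"
    then have "p x \<le> p 0" using p_less[of 0 x] by (cases "x = 0") auto
    then have "(E - p 0)\<^sup>2 \<le> (E - p x)\<^sup>2" using assms(2) by (intro power_mono) auto
    then have "Q (p 0) \<le> Q (p x)" unfolding Q_eq by (simp add: power2_commute)
    with low show "W\<^sup>2 * ((1 - E\<^sup>2) / g E) \<le> Q (p x)" by simp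
  qed (use sq gE assms in auto)
  then show ?thesis using l gE sq by (simp add: field_simps)
qed

text \<open>With q = - p 1, p 0 - q \<le> 1 - q^2 \<le> g (p 1) and \<kappa> \<le> g (p 0). So in
  \<open>boundary_sum\<close> the term with W^2 is at most W^2, while p 0 - q < 1.\<close>

lemma W_bound_p1_nonpos:
  assumes "p 1 \<le> 0"
  shows "2 * E < 1 + W\<^sup>2"
proof -
  define q where "q = - p 1"
  have q: "0 \<le> q" "q < 1" "p 0 < 1" "p 0 - q \<ge> 0"
    using assms abs_p_less_1[of 1] abs_p_less_1[of 0] boundary_sum_nonneg by (auto simp: q_def)
  have "p 0 - q \<le> 1 - q\<^sup>2"
    using q power2_le_iff_abs_le[of q] mult_left_le[of q q] by (simp add: power2_eq_square)
  also have "\<dots> \<le> g (p 1)"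
    using \<kappa> by (simp add: g_def q_def algebra_simps)
  finally have "\<kappa> * (p 0 - q) \<le> g (p 0) * g (p 1)"
    using g_ge[OF p_square_le_1[of 0]] \<kappa> q by (intro mult_mono) auto
  then have "(p 0 - q) * \<kappa> / (g (p 0) * g (p 1)) \<le> 1"
    using g_p_pos by (simp add: mult.commute)
  then have "W\<^sup>2 * ((p 0 - q) * \<kappa> / (g (p 0) * g (p 1))) \<le> W\<^sup>2 * 1"
    by (rule mult_left_mono) simp
  then show ?thesis
    using boundary_sum q by (simp add: q_def algebra_simps)
qed

text \<open>Prepares the comparison of \<kappa> W^2 with g E: g (p 0) is compared with g E through p
  0 and E, and the other factor with 1.\<close>

lemma \<kappa>_W_square:
  assumes "p 0 + p 1 > 0"
  shows "\<kappa> * W\<^sup>2 = g (p 0) * (g (p 1) * (2 * E - (p 0 + p 1)) / (p 0 + p 1))"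
proof -
  have "(p 0 + p 1) * (\<kappa> * W\<^sup>2 / (g (p 0) * g (p 1))) = 2 * E - (p 0 + p 1)"
    using boundary_sum by (simp add: algebra_simps)
  then show ?thesis using assms g_p_pos[of 0] g_p_pos[of 1] by (simp add: field_simps)
qed

text \<open>In \<open>boundary_sum\<close>, g \<ge> \<kappa> at both ends bounds the factor by 1 +
  W^2 / \<kappa>, and p 0 + p 1 < 2.\<close>

lemma E_bound: "E < 1 + W\<^sup>2 / \<kappa>"
proof -
  have "\<kappa> * \<kappa> \<le> g (p 0) * g (p 1)"
    using g_ge[OF p_square_le_1] \<kappa> by (intro mult_mono) (auto intro: order_trans[OF less_imp_le])
  then have "\<kappa> * W\<^sup>2 / (g (p 0) * g (p 1)) \<le> \<kappa> * W\<^sup>2 / (\<kappa> * \<kappa>)"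
    using \<kappa> g_p_pos by (intro divide_left_mono) auto
  then have "1 + \<kappa> * W\<^sup>2 / (g (p 0) * g (p 1)) \<le> 1 + W\<^sup>2 / \<kappa>"
    using \<kappa> by simp
  then have "2 * E \<le> (p 0 + p 1) * (1 + W\<^sup>2 / \<kappa>)"
    unfolding boundary_sum[symmetric] by (rule mult_left_mono) (rule boundary_sum_nonneg)
  also have "\<dots> < 2 * (1 + W\<^sup>2 / \<kappa>)"
    using abs_p_less_1[of 0] abs_p_less_1[of 1] \<kappa>
    by (intro mult_strict_right_mono add_pos_nonneg) auto
  finally show ?thesis by simp
qed

text \<open>p crosses E with positive slope, so D > E^2 and Q (p 1) > (E - p 1)^2 \<ge> E^2. The
  boundary identity gives Q (p 1) \<le> W^2, because 1 - t^2 \<le> g t.\<close>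

lemma W_gt_E:
  assumes "p 0 > E" "p 1 < 0"
  shows "W > E"
proof -
  have "\<exists>x\<ge>0. x \<le> 1 \<and> p x = E"
    using assms E continuous_p by (intro IVT2') auto
  then obtain x where x: "x \<in> {0..1}" "p x = E" by auto
  have "0 < l\<^sup>2 * Q (p x)"
    unfolding energy[OF x(1), symmetric] using \<theta>'_pos[OF x(1)] g_p_pos[of x] by simp
  then have "Q E > 0" using l x(2) by (simp add: zero_less_mult_iff)
  then have d: "D - E\<^sup>2 > 0" by (simp add: Q_eq)
  have "E\<^sup>2 \<le> (E - p 1)\<^sup>2" using E assms by (intro power_mono) auto
  also have "\<dots> < Q (p 1)" using d by (simp add: Q_eq power2_commute)
  also have "\<dots> = W\<^sup>2 * ((1 - (p 1)\<^sup>2) / g (p 1))" using boundary_energy[of 1] by simp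
  also have "\<dots> \<le> W\<^sup>2 * 1"
    using g_p_pos[of 1] \<kappa> by (intro mult_left_mono) (auto simp: g_def algebra_simps)
  finally show ?thesis using W by (simp add: power2_less_imp_less)
qed

lemma \<kappa>_W_less:
  assumes "p 0 > E" "p 1 > 0"
  shows "\<kappa> * W\<^sup>2 < g E"
proof -
  have S: "p 0 + p 1 > 0" "E < p 0 + p 1" using assms E by auto
  \<comment> \<open>Positivity of 2 E - (p 0 + p 1) is what permits multiplying g \<le> 1 by
    it.\<close>
  have "2 * E = (p 0 + p 1) * (1 + \<kappa> * W\<^sup>2 / (g (p 0) * g (p 1)))" using boundary_sum by simp
  moreover have "\<dots> > (p 0 + p 1) * 1"
    using S sum_factor_gt_1 by (intro mult_strict_left_mono) auto
  ultimately have "0 < 2 * E - (p 0 + p 1)" by simp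
  then have "g (p 1) * (2 * E - (p 0 + p 1)) \<le> 1 * (2 * E - (p 0 + p 1))"
    using g_le_1 by (intro mult_right_mono) auto
  also have "\<dots> \<le> p 0 + p 1" using S by simp
  finally have "g (p 1) * (2 * E - (p 0 + p 1)) / (p 0 + p 1) \<le> 1" using S by simp
  then have "\<kappa> * W\<^sup>2 \<le> g (p 0) * 1"
    unfolding \<kappa>_W_square[OF S(1)] using g_p_pos[of 0] by (intro mult_left_mono) auto
  also have "\<dots> < g E"
    using assms E \<kappa> power_strict_mono[of E "p 0" 2] by (simp add: g_def)
  finally show ?thesis .
qed

lemma \<kappa>_W_greater:
  assumes "E < 1" "p 0 < E" "p 1 < 0"
  shows "\<kappa> * W\<^sup>2 > g E"
proof -
  define q where "q = - p 1"
  \<comment> \<open>A zero sum would force E = 0, making both p 0 and p 1 negative.\<close>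
  have "p 0 + p 1 \<noteq> 0" using boundary_sum assms boundary_sum_nonneg by auto
  then have S: "p 0 + p 1 > 0" using boundary_sum_nonneg by simp
  have q: "0 < q" "q < p 0" "q < 1" "q < E" using S assms by (auto simp: q_def)
  \<comment> \<open>This expression is (1 - q^2) (E + q) - (E - q), expanded.\<close>
  have "0 < q * (2 - q * E - q * q)"
  proof -
    have "q * E < 1" "q * q < 1" using q assms mult_strict_mono[of q 1 E 1] mult_strict_mono[of q 1 q 1] by auto
    then show ?thesis using q by simp
  qed
  then have "E - q < (1 - q\<^sup>2) * (E + q)" by (simp add: power2_eq_square algebra_simps)
  also have "\<dots> \<le> g (p 1) * (E + q)"
    using q \<kappa> by (intro mult_right_mono) (auto simp: g_def q_def algebra_simps)
  also have "\<dots> \<le> g (p 1) * (2 * E - (p 0 + p 1))"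
    using assms g_p_pos[of 1] by (intro mult_left_mono) (auto simp: q_def)
  finally have "p 0 + p 1 < g (p 1) * (2 * E - (p 0 + p 1))" using assms by (simp add: q_def)
  then have "1 < g (p 1) * (2 * E - (p 0 + p 1)) / (p 0 + p 1)" using S by simp
  then have "g (p 0) * 1 < \<kappa> * W\<^sup>2"
    unfolding \<kappa>_W_square[OF S] using g_p_pos[of 0] by (intro mult_strict_left_mono) auto
  moreover have "g E < g (p 0)"
    using assms q \<kappa> power_strict_mono[of "p 0" E 2] by (simp add: g_def)
  ultimately show ?thesis by simp
qed

end

section \<open>Specialisation to the original problem\<close>

theorem theorem2p6:
  fixes W_S E_B L \<xi> \<kappa> :: real and \<theta> :: "real \<Rightarrow> real"
  assumes "W_S > 0" and "E_B \<ge> 0" and "L > 0" and "\<xi> > 0" and "L / \<xi> \<ge> 1"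
    and "0 < \<kappa>" and "\<kappa> < 1"
    and "bvp_solution W_S E_B L \<xi> \<kappa> \<theta>"
    and "\<not> \<theta> constant_on {0..1}"
  shows
    "(E_B < 1 \<longrightarrow>
        (p_x \<theta> 0 > E_B \<and> p_x \<theta> 1 < 0 \<longrightarrow>
           (E_B \<ge> 1 / 2 \<longrightarrow> W_S > max (E_B * (\<xi> / L)) (sqrt (2 * E_B - 1))) \<and>
           (E_B \<in> {0..<1 / 2} \<longrightarrow> W_S > E_B * (\<xi> / L))) \<and>
        (p_x \<theta> 0 > E_B \<and> p_x \<theta> 1 > 0 \<longrightarrow>
           W_S < min (sqrt ((1 - (1 - \<kappa>) * E_B\<^sup>2) / \<kappa>))
                     (sqrt (E_B\<^sup>2 + (1 + \<kappa>) / 8 * (pi * \<xi> / L)\<^sup>2))) \<and>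
        (p_x \<theta> 0 < E_B \<and> p_x \<theta> 1 < 0 \<longrightarrow>
           sqrt ((1 - (1 - \<kappa>) * E_B\<^sup>2) / \<kappa>) < W_S \<and>
           W_S < pi * \<xi> / L *
                 sqrt (((1 + \<kappa>) - (1 - \<kappa>\<^sup>2) * E_B\<^sup>2) / (2 * (1 - E_B\<^sup>2)))) \<and>
        (p_x \<theta> 0 < E_B \<and> p_x \<theta> 1 > 0 \<longrightarrow>
           W_S < min (sqrt (E_B\<^sup>2 + (1 + \<kappa>) / 8 * (pi * \<xi> / L)\<^sup>2))
                     (pi * \<xi> / L *
                      sqrt ((1 + \<kappa>) / 8 * ((1 - (1 - \<kappa>) * E_B\<^sup>2) / (1 - E_B\<^sup>2)))))) \<and>
     (E_B < 1 \<longrightarrow>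
        W_S > max (sqrt (E_B\<^sup>2 + (1 + \<kappa>) / 2 * (pi * \<xi> / L)\<^sup>2))
                  (pi * \<xi> / L *
                   sqrt ((1 + \<kappa>) / 2 * (1 + \<kappa> * E_B\<^sup>2 / (1 - E_B\<^sup>2)))) \<longrightarrow>
        p_x \<theta> 0 > E_B \<and> p_x \<theta> 1 < 0) \<and>
     (E_B > (1 + W_S\<^sup>2) / 2 \<longrightarrow> p_x \<theta> 1 > 0) \<and>
     (E_B > 1 + W_S\<^sup>2 / \<kappa> \<longrightarrow> (\<forall>x\<in>{0..1}. p_x \<theta> x = 1))"
proof -
  have D_\<theta>: "(dI ^^ n) \<theta> differentiable_on {0..1}" for n
    using assms(8) by (simp add: bvp_solution_def smoothI_def)
  have der: "(f has_real_derivative dI f x) (at x within {0..1})"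
    if "f differentiable_on {0..1}" "x \<in> {0..1}" for f :: "real \<Rightarrow> real" and x
    using that unfolding dI_def differentiable_on_def
    by (simp add: has_real_derivative_iff_has_vector_derivative vector_derivative_works[symmetric])
  interpret nematic_bvp W_S E_B "L / \<xi>" \<kappa> \<theta> "dI \<theta>" "dI (dI \<theta>)"
  proof
    show "\<And>x. x \<in> {0..1} \<Longrightarrow> (\<theta> has_real_derivative dI \<theta> x) (at x within {0..1})"
      using der D_\<theta>[of 0] by simp
    show "\<And>x. x \<in> {0..1} \<Longrightarrow> (dI \<theta> has_real_derivative dI (dI \<theta>) x) (at x within {0..1})"
      using der D_\<theta>[of 1] by simp
    show "\<And>x. x \<in> {0..1} \<Longrightarrow> \<theta> x \<in> {0..pi}"
      using assms(8) by (auto simp: bvp_solution_def)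
    show "\<And>x. x \<in> {0, 1} \<Longrightarrow>
        ((sin (\<theta> x))\<^sup>2 + \<kappa> * (cos (\<theta> x))\<^sup>2) * dI \<theta> x = W_S * (L / \<xi>) * sin (\<theta> x)"
      using assms(8) by (auto simp: bvp_solution_def boundary_cond_def)
  qed (use assms in \<open>auto simp: bvp_solution_def euler_lagrange_def\<close>)
  have p_x: "p_x \<theta> x = p x" for x by (simp add: p_x_def p_def)
  have g_E: "1 - (1 - \<kappa>) * E_B\<^sup>2 = g E_B" by (simp add: g_def)
  have scale: "(b * \<xi> / L)\<^sup>2 = (b / (L / \<xi>))\<^sup>2" for b by simp
  have scale_pos: "pi * \<xi> / L > 0" using assms by simp
  have less_scaled_sqrt: "W_S < pi * \<xi> / L * sqrt y" if "W_S\<^sup>2 < (pi * \<xi> / L)\<^sup>2 * y" for y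
    using real_less_rsqrt[OF that] scale_pos unfolding real_sqrt_mult real_sqrt_abs by linarith
  note p1_nonneg = W_bound_p1_nonneg[folded scale]
  \<comment> \<open>\<open>W_bound_p0_le\<close> is used with b = \<pi>, available from the range of
    \<theta>, and then with b = \<pi>/2 for p 1 \<ge> 0, where (\<pi>/2)^2 turns 1/2 into
    1/8.\<close>
  have p0_le: "W_S\<^sup>2 < (pi * \<xi> / L)\<^sup>2 * ((1 + \<kappa>) / 2 * (g E_B / (1 - E_B\<^sup>2)))"
    if "E_B < 1" "p 0 \<le> E_B"
    using W_bound_p0_le[OF that, of pi] range[of 1] by (simp add: mult_ac flip: scale)
  have p0_le_p1_nonneg: "W_S\<^sup>2 < (pi * \<xi> / L)\<^sup>2 * ((1 + \<kappa>) / 8 * (g E_B / (1 - E_B\<^sup>2)))"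
    if "E_B < 1" "p 0 \<le> E_B" "p 1 \<ge> 0"
    using W_bound_p0_le[OF that(1,2) \<theta>_1_le_half_pi[OF that(3)]] by (simp add: field_simps)

  have part_1a: "W_S > E_B * (\<xi> / L)" "W_S > sqrt (2 * E_B - 1)"
    if "p 0 > E_B" "p 1 < 0"
  proof -
    \<comment> \<open>The stronger bound W > E is weakened by \<xi> / L \<le> 1.\<close>
    have "\<xi> / L \<le> 1" using l assms(3,4) by (simp add: field_simps)
    then have "E_B * (\<xi> / L) \<le> E_B * 1" by (rule mult_left_mono) (rule E)
    then show "W_S > E_B * (\<xi> / L)" using W_gt_E[OF that] by simp
    show "W_S > sqrt (2 * E_B - 1)"
      using W_bound_p1_nonpos that W by (intro real_less_lsqrt) auto
  qed
  have part_1b: "W_S < sqrt (g E_B / \<kappa>)" if "p 0 > E_B" "p 1 > 0"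
    using \<kappa>_W_less[OF that] \<kappa> by (intro real_less_rsqrt) (simp add: field_simps)
  have part_1bd: "W_S < sqrt (E_B\<^sup>2 + (1 + \<kappa>) / 8 * (pi * \<xi> / L)\<^sup>2)" if "p 1 > 0"
    using p1_nonneg that by (intro real_less_rsqrt) simp
  have part_1c: "sqrt (g E_B / \<kappa>) < W_S"
      "W_S < pi * \<xi> / L * sqrt (((1 + \<kappa>) - (1 - \<kappa>\<^sup>2) * E_B\<^sup>2) / (2 * (1 - E_B\<^sup>2)))"
    if "E_B < 1" "p 0 < E_B" "p 1 < 0"
  proof -
    show "sqrt (g E_B / \<kappa>) < W_S"
      using \<kappa>_W_greater[OF that] \<kappa> W by (intro real_less_lsqrt) (auto simp: field_simps)
    have "(1 + \<kappa>) - (1 - \<kappa>\<^sup>2) * E_B\<^sup>2 = (1 + \<kappa>) * g E_B"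
      by (simp add: g_def power2_eq_square algebra_simps)
    then have eq: "((1 + \<kappa>) - (1 - \<kappa>\<^sup>2) * E_B\<^sup>2) / (2 * (1 - E_B\<^sup>2)) = (1 + \<kappa>) / 2 * (g E_B / (1 - E_B\<^sup>2))"
      by simp
    show "W_S < pi * \<xi> / L * sqrt (((1 + \<kappa>) - (1 - \<kappa>\<^sup>2) * E_B\<^sup>2) / (2 * (1 - E_B\<^sup>2)))"
      unfolding eq using that by (intro less_scaled_sqrt p0_le) auto
  qed
  have part_1d: "W_S < pi * \<xi> / L * sqrt ((1 + \<kappa>) / 8 * (g E_B / (1 - E_B\<^sup>2)))"
    if "E_B < 1" "p 0 < E_B" "p 1 > 0"
    using less_scaled_sqrt p0_le_p1_nonneg that by simp
  have part_2: "p 0 > E_B \<and> p 1 < 0"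
    if "E_B < 1" and W_gt: "W_S > sqrt (E_B\<^sup>2 + (1 + \<kappa>) / 2 * (pi * \<xi> / L)\<^sup>2)"
      "W_S > pi * \<xi> / L * sqrt ((1 + \<kappa>) / 2 * (1 + \<kappa> * E_B\<^sup>2 / (1 - E_B\<^sup>2)))"
  proof (rule ccontr)
    assume "\<not> ?thesis"
    then consider "p 1 \<ge> 0" | "p 0 \<le> E_B" by linarith
    then show False
    proof cases
      \<comment> \<open>The bound with 1/8 already contradicts the first threshold, which has
        1/2.\<close>
      case 1
      have "E_B\<^sup>2 + (1 + \<kappa>) / 8 * (pi * \<xi> / L)\<^sup>2 \<le> E_B\<^sup>2 + (1 + \<kappa>) / 2 * (pi * \<xi> / L)\<^sup>2"
        using \<kappa> by (intro add_left_mono mult_right_mono) auto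
      with p1_nonneg[OF 1] have "W_S < sqrt (E_B\<^sup>2 + (1 + \<kappa>) / 2 * (pi * \<xi> / L)\<^sup>2)"
        by (intro real_less_rsqrt) linarith
      then show False using W_gt(1) by simp
    next
      \<comment> \<open>The second threshold is exactly the upper bound \<open>p0_le\<close>,
        rewritten by 1 - E^2 + \<kappa> E^2 = g E.\<close>
      case 2
      have "E_B\<^sup>2 < 1" using that(1) E by (simp add: abs_square_less_1)
      then have "1 + \<kappa> * E_B\<^sup>2 / (1 - E_B\<^sup>2) = g E_B / (1 - E_B\<^sup>2)"
        by (simp add: g_def field_simps)
      then show False
        using less_scaled_sqrt[OF p0_le[OF that(1) 2]] W_gt(2) by simp
    qed
  qed
  have part_3: "p 1 > 0" if "E_B > (1 + W_S\<^sup>2) / 2"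
    using W_bound_p1_nonpos that by (cases "p 1 > 0") auto
  \<comment> \<open>The final assertion holds vacuously: its hypothesis contradicts
    \<open>E_bound\<close>.\<close>
  show ?thesis
    unfolding p_x g_E
    using part_1a part_1b part_1bd part_1c part_1d part_2 part_3 E_bound by simp
qed

end
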